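(* Let constants $\mu,L,V$ and a piecewise affine inflow profile $Q:[0,T]\to\mathbb{R}_+$ with break points $\{\xi_i\in\mathbb{R}: i\in\mathcal{I}\}$ (with $0$ counted as a break point) be given. Associate with each time $t\ge L/V$ the finite set $\Omega_t=\{\xi_i:\ \xi_i\le t-L/V\}\cup\{t-L/V\}$. Given the initial conditions $q(0)=q_0$ and $\rho(0,x)=\rho_0(x)$, where $q_0\ge 0$ is the initial queue size and $\rho_0\in L^1([0,L])$ is the initial product density on the processor, define $\hat Q(t)=0$ for $t\le 0$ and $\hat Q(t)=q_0+Q(t)$ for $0<t\le T$. Then the exit flow profile $U(t,L)$ (the cumulative number of products that have left the processor by time $t$) can be written as $$U(t,L)=\begin{cases}\displaystyle\int_{L-Vt}^{L}\rho_0(\zeta)\,d\zeta, & t\in[0,L/V),\\[2mm] \displaystyle\min_{\tau\in\Omega_t}\{\hat Q(\tau)-\mu\tau\}+(t-L/V)\mu+\int_0^L\rho_0(\zeta)\,d\zeta, & t\in[L/V,T].\end{cases}$$ Moreover, $U(\cdot,L)$ is Lipschitz continuous.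
   Context: A processor is the spatial interval $[0,L]$ with constant processing speed $V>0$ and constant flow capacity $\mu>0$, preceded by a buffer queue at $x=0$; $T>0$ is the time horizon. $Q(t)$ is the cumulative number of products that have arrived at the queue by time $t$; it is non-decreasing and left-continuous, and is extended by $Q(t)=0$ for $t<0$. Piecewise affine means affine between consecutive break points; upward jumps at break points are allowed. An initial queue $q_0$ is incorporated by replacing $Q$ with $\hat Q$. The cumulative number of products released from the queue into the processor by time $t\ge0$ is $$\overline U(t)=\inf_{\tau\le t}\{\hat Q(\tau)+\mu(t-\tau)\}.$$ The product density $\rho(t,x)$ on the processor solves the advection equation $\partial_t\rho+V\partial_x\rho=0$ on $[0,T]\times[0,L]$ with $\rho(0,x)=\rho_0(x)$ and boundary inflow $V\rho(t,0)=\frac{d}{dt}\overline U(t)$ for a.e. $t$. The exit flow profile is $U(t,L)=\int_0^tV\rho(s,L)\,ds$.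
   Formalization: Lipschitz continuity of U(·,L) on all of [0,T] is proved only for essentially bounded ρ_0 (on [L/V,T] for every ρ_0 in L^1): for ρ_0(x)=1/(2√(L−x)) the formula gives U(t,L)=√(Vt) near t=0, which is not Lipschitz. *)

theory Defs
  imports "HOL-Analysis.Analysis"
begin

(* Affine on every open subinterval of [0,T] that contains no break point. The stretch from the
   last break point up to T is included. Values at the break points are not constrained
   here, so jumps are allowed; that they are upward comes from monotonicity of Q. *)
definition piecewise_affine :: "real \<Rightarrow> real set \<Rightarrow> (real \<Rightarrow> real) \<Rightarrow> bool" where
  "piecewise_affine T \<Xi> Q \<longleftrightarrow>
     0 \<in> \<Xi> \<and> finite (\<Xi> \<inter> {..T}) \<and>
     (\<forall>a b. 0 \<le> a \<and> a < b \<and> b \<le> T \<and> {a<..<b} \<inter> \<Xi> = {} \<longrightarrow>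
        (\<exists>c d. \<forall>t\<in>{a<..<b}. Q t = c + d * t))"

(* Q is a function on [0,T]; its values elsewhere are irrelevant. The nonpositive times, where the
   cumulative arrivals vanish, are handled by Q_hat below. *)
definition inflow_profile :: "real \<Rightarrow> real set \<Rightarrow> (real \<Rightarrow> real) \<Rightarrow> bool" where
  "inflow_profile T \<Xi> Q \<longleftrightarrow>
     Q \<in> {0..T} \<rightarrow> {0..} \<and> mono_on {0..T} Q \<and>
     (\<forall>t\<in>{0<..T}. continuous (at_left t) Q) \<and> piecewise_affine T \<Xi> Q"

definition Q_hat :: "real \<Rightarrow> (real \<Rightarrow> real) \<Rightarrow> real \<Rightarrow> real" where
  "Q_hat q0 Q t = (if t \<le> 0 then 0 else q0 + Q t)"

definition release_profile :: "real \<Rightarrow> real \<Rightarrow> (real \<Rightarrow> real) \<Rightarrow> real \<Rightarrow> real" where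
  "release_profile \<mu> q0 Q t = (INF \<tau>\<in>{..t}. Q_hat q0 Q \<tau> + \<mu> * (t - \<tau>))"

definition C1_partials ::
    "(real \<Rightarrow> real \<Rightarrow> real) \<Rightarrow> (real \<Rightarrow> real \<Rightarrow> real) \<Rightarrow> (real \<Rightarrow> real \<Rightarrow> real) \<Rightarrow> bool" where
  "C1_partials \<phi> \<phi>t \<phi>x \<longleftrightarrow>
     (\<forall>t x. ((\<lambda>s. \<phi> s x) has_real_derivative \<phi>t t x) (at t)) \<and>
     (\<forall>t x. ((\<lambda>y. \<phi> t y) has_real_derivative \<phi>x t x) (at x)) \<and>
     continuous_on UNIV (\<lambda>(t, x). \<phi>t t x) \<and> continuous_on UNIV (\<lambda>(t, x). \<phi>x t x)"

(* Weak solutions of rho_t + V rho_x = 0 on [0,T] x [0,L]. For initial data that are merely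
   integrable the equation cannot be understood pointwise. The identity is the equation
   multiplied by a test function vanishing for t >= T and integrated by parts; rho 0 x, rho t 0 and
   rho t L are the traces of rho on the three remaining edges of the rectangle. *)
definition advection_solution ::
    "real \<Rightarrow> real \<Rightarrow> real \<Rightarrow> (real \<Rightarrow> real \<Rightarrow> real) \<Rightarrow> bool" where
  "advection_solution V T L \<rho> \<longleftrightarrow>
     (\<lambda>(t, x). \<rho> t x) absolutely_integrable_on {0..T} \<times> {0..L} \<and>
     (\<lambda>x. \<rho> 0 x) absolutely_integrable_on {0..L} \<and>
     (\<lambda>t. \<rho> t 0) absolutely_integrable_on {0..T} \<and>
     (\<lambda>t. \<rho> t L) absolutely_integrable_on {0..T} \<and>
     (\<forall>\<phi> \<phi>t \<phi>x. C1_partials \<phi> \<phi>t \<phi>x \<and> (\<forall>t\<ge>T. \<forall>x\<in>{0..L}. \<phi> t x = 0) \<longrightarrow>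
        integral ({0..T} \<times> {0..L}) (\<lambda>(t, x). \<rho> t x * (\<phi>t t x + V * \<phi>x t x))
        + integral {0..L} (\<lambda>x. \<rho> 0 x * \<phi> 0 x)
        + integral {0..T} (\<lambda>t. V * \<rho> t 0 * \<phi> t 0)
        - integral {0..T} (\<lambda>t. V * \<rho> t L * \<phi> t L) = 0)"

definition exit_flow :: "real \<Rightarrow> real \<Rightarrow> (real \<Rightarrow> real \<Rightarrow> real) \<Rightarrow> real \<Rightarrow> real" where
  "exit_flow V L \<rho> t = integral {0..t} (\<lambda>s. V * \<rho> s L)"

definition Omega :: "real set \<Rightarrow> real \<Rightarrow> real \<Rightarrow> real \<Rightarrow> real set" where
  "Omega \<Xi> L V t = {\<xi> \<in> \<Xi>. \<xi> \<le> t - L / V} \<union> {t - L / V}"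

end

theory Submission
  imports Defs
begin

text \<open>Testing the weak equation against functions \<open>h (t + (L - x) / V)\<close>, which are constant along
  characteristics, removes the area integral. Letting \<open>h\<close> increase to the indicator of the times
  before \<open>s\<close> yields that the outflow up to time \<open>s\<close> equals the initial mass on
  \<open>[max 0 (L - V s), L]\<close> plus the inflow up to time \<open>s - L / V\<close>. The release profile vanishes at
  time 0 and is Lipschitz, so it is the integral of its a.e. derivative and equals that inflow; its
  infimum is attained at a break point or at the final time because cumulative arrivals minus
  capacity are affine in between.\<close>

section \<open>Integrating the a.e. derivative of a Lipschitz function\<close>

text \<open>The difference quotients of \<open>f\<close> (clamped outside the interval) are bounded by \<open>C\<close>, so by
  dominated convergence their integrals, which telescope to averages of \<open>f\<close> near the two ends,
  tend to the integral of the derivative.\<close>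

lemma has_integral_derivative_of_lipschitz:
  fixes f f' :: "real \<Rightarrow> real"
  assumes "a \<le> b" and lip: "C-lipschitz_on {a..b} f" and N: "negligible N"
    and der: "\<And>x. x \<in> {a..b} - N \<Longrightarrow> (f has_real_derivative f' x) (at x)"
  shows "(f' has_integral f b - f a) {a..b}"
proof -
  define g where "g x = f (max a (min b x))" for x
  define h where "h k = inverse (real (Suc k))" for k
  have h: "h k > 0" "h k \<le> 1" for k
    by (auto simp: h_def field_simps)
  have h0: "h \<longlonglongrightarrow> 0"
    unfolding h_def by (rule LIMSEQ_inverse_real_of_nat)
  have h_at: "filterlim h (at 0) sequentially"
    unfolding filterlim_at using h0 h by (auto intro!: always_eventually simp: less_imp_neq[symmetric])
  have C: "C \<ge> 0" using lip by (rule lipschitz_on_nonneg)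
  have glip: "\<bar>g x - g y\<bar> \<le> C * \<bar>x - y\<bar>" for x y
  proof -
    have "\<bar>g x - g y\<bar> \<le> C * \<bar>max a (min b x) - max a (min b y)\<bar>"
      using lipschitz_onD[OF lip, of "max a (min b x)" "max a (min b y)"] \<open>a \<le> b\<close>
      by (auto simp: g_def dist_real_def)
    also have "\<dots> \<le> C * \<bar>x - y\<bar>"
      by (rule mult_left_mono[OF _ C]) linarith
    finally show ?thesis .
  qed
  have "C-lipschitz_on UNIV g"
    using C glip by (auto intro!: lipschitz_onI simp: dist_real_def)
  then have gcont: "continuous_on UNIV g"
    by (rule lipschitz_on_continuous_on)
  \<comment> \<open>The margins make every point of [a, b + 1] interior, and since
    \<open>h k \<le> 1\<close> this covers all shifted points \<open>x + h k\<close>.\<close>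
  obtain G where G0: "\<And>x. x \<in> {a-1..b+2} \<Longrightarrow>
      (G has_vector_derivative g x) (at x within {a-1..b+2})"
    using antiderivative_continuous[OF continuous_on_subset[OF gcont subset_UNIV]] by metis
  have G: "(G has_real_derivative g x) (at x)" if "a \<le> x" "x \<le> b + 1" for x
  proof -
    have "at x within {a-1..b+2} = at x"
      using that by (intro at_within_interior) auto
    then show ?thesis
      using G0[of x] that by (simp add: has_real_derivative_iff_has_vector_derivative)
  qed
  \<comment> \<open>The end points join the null set because clamping may give \<open>g\<close>
    kinks there. Overwriting by 0 on \<open>N'\<close> then yields convergence at every point of the
    interval, as the dominated convergence theorem demands.\<close>
  define N' where "N' = N \<union> {a, b}"
  have N': "negligible N'" unfolding N'_def using N by simp
  define d where "d k x = (if x \<in> N' then 0 else (g (x + h k) - g x) / h k)" for k x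
  define f2 where "f2 x = (if x \<in> N' then 0 else f' x)" for x
  have dint: "(d k has_integral (G (b + h k) - G b) / h k - (G (a + h k) - G a) / h k) {a..b}" for k
  proof -
    have "((\<lambda>x. (g (x + h k) - g x) / h k) has_integral
          (G (b + h k) - G b) / h k - (G (a + h k) - G a) / h k) {a..b}"
    proof (rule fundamental_theorem_of_calculus[OF \<open>a \<le> b\<close>])
      fix x assume x: "x \<in> {a..b}"
      have "((\<lambda>x. (G (x + h k) - G x) / h k) has_real_derivative (g (x + h k) - g x) / h k) (at x)"
        using x h[of k]
        by (intro DERIV_cdivide DERIV_diff G DERIV_shift[THEN iffD1]) auto
      then show "((\<lambda>x. (G (x + h k) - G x) / h k) has_vector_derivative (g (x + h k) - g x) / h k)
          (at x within {a..b})"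
        by (simp add: has_real_derivative_iff_has_vector_derivative has_vector_derivative_at_within)
    qed
    then show ?thesis
      by (rule has_integral_spike[OF N', rotated]) (auto simp: d_def)
  qed
  \<comment> \<open>The quotient is the average of \<open>g\<close> over [x, x + h k]; taken at
    \<open>a\<close> and \<open>b\<close> it supplies the two ends of the telescoped
    integral.\<close>
  have quot: "(\<lambda>k. (G (x + h k) - G x) / h k) \<longlonglongrightarrow> g x" if "a \<le> x" "x \<le> b + 1" for x
    using filterlim_compose[OF G[OF that, unfolded DERIV_def] h_at] .
  have "(f2 has_integral g b - g a) {a..b}"
  proof (rule has_integral_dominated_convergence[OF dint])
    show "(\<lambda>_. C) integrable_on {a..b}" by (rule integrable_const_ivl)
    show "\<forall>x\<in>{a..b}. norm (d k x) \<le> C" for k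
    proof
      fix x
      have "\<bar>g (x + h k) - g x\<bar> \<le> C * h k"
        using glip[of "x + h k" x] h[of k] by simp
      then show "norm (d k x) \<le> C"
        using h[of k] C by (simp add: d_def abs_divide pos_divide_le_eq)
    qed
    show "\<forall>x\<in>{a..b}. (\<lambda>k. d k x) \<longlonglongrightarrow> f2 x"
    proof
      fix x assume x: "x \<in> {a..b}"
      show "(\<lambda>k. d k x) \<longlonglongrightarrow> f2 x"
      proof (cases "x \<in> N'")
        case False
        then have x': "x \<in> {a<..<b}" using x by (auto simp: N'_def)
        have "(g has_real_derivative f' x) (at x)"
        proof (rule DERIV_cong_ev[THEN iffD2, OF refl _ refl])
          show "\<forall>\<^sub>F x in nhds x. g x = f x"
            using eventually_nhds_in_open[OF open_greaterThanLessThan x']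
            by eventually_elim (auto simp: g_def)
          show "(f has_real_derivative f' x) (at x)" using False x by (auto simp: N'_def intro!: der)
        qed
        then show ?thesis
          using False filterlim_compose[OF _ h_at] by (fastforce simp: DERIV_def d_def f2_def)
      qed (simp add: d_def f2_def)
    qed
    show "(\<lambda>k. (G (b + h k) - G b) / h k - (G (a + h k) - G a) / h k) \<longlonglongrightarrow> g b - g a"
      using \<open>a \<le> b\<close> by (intro tendsto_diff quot) auto
  qed
  then have "(f' has_integral g b - g a) {a..b}"
    by (rule has_integral_spike[OF N', rotated]) (auto simp: f2_def)
  then show ?thesis using \<open>a \<le> b\<close> by (simp add: g_def)
qed

section \<open>Cutoff functions and passage to indicators\<close>

text \<open>Dominated convergence with bound |f|; continuity of the cutoffs makes the products
  measurable. In the applications \<open>S\<close> is an open half-line, since the cutoffs vanish on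
  its boundary.\<close>

lemma tendsto_integral_mult_cutoff:
  fixes f :: "real \<Rightarrow> real" and h :: "nat \<Rightarrow> real \<Rightarrow> real"
  assumes f: "f absolutely_integrable_on {a..b}"
    and hc: "\<And>k. continuous_on {a..b} (h k)"
    and h1: "\<And>k x. \<bar>h k x\<bar> \<le> 1"
    and lim: "\<And>x. x \<in> {a..b} \<Longrightarrow> (\<lambda>k. h k x) \<longlonglongrightarrow> (if x \<in> S then 1 else 0)"
  shows "(\<lambda>k. integral {a..b} (\<lambda>x. f x * h k x)) \<longlonglongrightarrow> integral (S \<inter> {a..b}) f"
proof -
  have "(\<lambda>k. integral {a..b} (\<lambda>x. f x * h k x)) \<longlonglongrightarrow>
      integral {a..b} (\<lambda>x. if x \<in> S then f x else 0)"
  proof (rule dominated_convergence(2))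
    fix k
    have "(\<lambda>x. h k x * f x) absolutely_integrable_on {a..b}"
    proof (rule absolutely_integrable_bounded_measurable_product_real[OF _ _ _ f])
      show "h k \<in> borel_measurable (lebesgue_on {a..b})"
        by (intro continuous_imp_measurable_on_sets_lebesgue hc) auto
      show "bounded (h k ` {a..b})"
        using h1 by (auto intro!: boundedI[of _ 1])
    qed auto
    then show "(\<lambda>x. f x * h k x) integrable_on {a..b}"
      by (simp add: mult.commute set_lebesgue_integral_eq_integral(1))
  next
    show "(\<lambda>x. \<bar>f x\<bar>) integrable_on {a..b}"
      using f by (simp add: absolutely_integrable_on_def)
    show "norm (f x * h k x) \<le> \<bar>f x\<bar>" for k x
      using mult_left_mono[OF h1, of "\<bar>f x\<bar>" k x] by (simp add: abs_mult)
    show "(\<lambda>k. f x * h k x) \<longlonglongrightarrow> (if x \<in> S then f x else 0)" if "x \<in> {a..b}" for x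
      using tendsto_mult[OF tendsto_const[of "f x"] lim[OF that]] by (simp split: if_splits)
  qed
  then show ?thesis by (simp add: Henstock_Kurzweil_Integration.integral_restrict_Int)
qed

text \<open>The witness is p u = 1 - 1 / (1 + max(0, u)^2). Squaring removes the kink of max(0, u)
  at 0, and the dilations p (k u) tend to the indicator of u > 0. Vanishing for
  \<open>u \<le> 0\<close> is what makes the later test functions zero from the time horizon
  on.\<close>

lemma C1_cutoff_exists:
  obtains p p' :: "real \<Rightarrow> real" where
    "\<And>u. (p has_real_derivative p' u) (at u)" "continuous_on UNIV p'"
    "\<And>u. u \<le> 0 \<Longrightarrow> p u = 0" "\<And>u. \<bar>p u\<bar> \<le> 1"
    "\<And>u. u > 0 \<Longrightarrow> (\<lambda>k. p (real (k::nat) * u)) \<longlonglongrightarrow> 1"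
proof -
  define m :: "real \<Rightarrow> real" where "m u = (max 0 u)\<^sup>2" for u
  have m0: "m u \<ge> 0" for u by (simp add: m_def)
  then have m1: "1 + m u > 0" for u by (smt (verit))
  have m: "(m has_real_derivative 2 * max 0 u) (at u)" for u
  proof -
    consider "u < 0" | "u = 0" | "u > 0" by linarith
    then show ?thesis
    proof cases
      case 1
      have "(m has_real_derivative 0) (at u)"
      proof (rule DERIV_cong_ev[THEN iffD2, OF refl _ refl])
        show "\<forall>\<^sub>F x in nhds u. m x = 0"
          using eventually_nhds_in_open[OF open_lessThan, of u 0] 1
          by (auto elim!: eventually_mono simp: m_def)
      qed simp
      then show ?thesis using 1 by simp
    next
      case 2
      \<comment> \<open>At 0 the difference quotient max(0, h)^2 / h is just max(0, h).\<close>
      have "((\<lambda>h::real. max 0 h) \<longlongrightarrow> max 0 0) (at 0)"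
        by (intro tendsto_intros)
      moreover have "\<forall>\<^sub>F h in at 0. max 0 h = (m (0 + h) - m 0) / h"
        by (auto simp: eventually_at_filter m_def power2_eq_square max_def)
      ultimately have "((\<lambda>h. (m (0 + h) - m 0) / h) \<longlongrightarrow> 0) (at 0)"
        using Lim_transform_eventually by force
      then show ?thesis using 2 by (simp add: DERIV_def)
    next
      case 3
      have "(m has_real_derivative 2 * u) (at u)"
      proof (rule DERIV_cong_ev[THEN iffD2, OF refl _ refl])
        show "\<forall>\<^sub>F x in nhds u. m x = x\<^sup>2"
          using eventually_nhds_in_open[OF open_greaterThan, of u 0] 3
          by (auto elim!: eventually_mono simp: m_def)
      qed (auto intro!: derivative_eq_intros)
      then show ?thesis using 3 by simp
    qed
  qed
  define p where "p u = 1 - inverse (1 + m u)" for u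
  define p' where "p' u = 2 * max 0 u * inverse ((1 + m u)^Suc (Suc 0))" for u
  show ?thesis
  proof
    show "(p has_real_derivative p' u) (at u)" for u
      unfolding p_def p'_def using m1[of u]
      by (auto intro!: derivative_eq_intros m simp: power2_eq_square)
    have "continuous_on UNIV m"
      using m by (meson DERIV_isCont continuous_at_imp_continuous_on)
    then show "continuous_on UNIV p'"
      unfolding p'_def using m1 by (intro continuous_intros) (auto simp: less_imp_neq[symmetric])
    show "p u = 0" if "u \<le> 0" for u using that by (simp add: p_def m_def)
    show "\<bar>p u\<bar> \<le> 1" for u
      using m0[of u] m1[of u] by (auto simp: p_def abs_le_iff field_simps)
    show "(\<lambda>k. p (real (k::nat) * u)) \<longlonglongrightarrow> 1" if "u > 0" for u
    proof -
      have "filterlim (\<lambda>k. real k * u) at_top sequentially"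
        using that by (intro filterlim_at_top_mult_tendsto_pos[OF tendsto_const _ filterlim_real_sequentially])
      then have "filterlim (\<lambda>k. (real k * u)\<^sup>2) at_top sequentially"
        by (rule filterlim_pow_at_top[rotated]) simp
      then have "filterlim (\<lambda>k. 1 + (real k * u)\<^sup>2) at_infinity sequentially"
        by (intro filterlim_at_top_imp_at_infinity filterlim_tendsto_add_at_top[OF tendsto_const])
      then have "(\<lambda>k. 1 - inverse (1 + (real k * u)\<^sup>2)) \<longlonglongrightarrow> 1 - 0"
        by (intro tendsto_diff tendsto_const filterlim_compose[OF tendsto_inverse_0])
      then show ?thesis using that by (simp add: p_def m_def max_def)
    qed
  qed
qed

section \<open>Mass balance from the weak equation\<close>

text \<open>Mass travels at speed \<open>V\<close>, so whatever leaves by time \<open>s\<close>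
  either started within distance V s of the exit or entered at least L / V earlier. The maxima with
  0 treat the regimes before and after time L / V at once.\<close>

lemma exit_flow_eq_integrals:
  assumes "V > 0" "L > 0" and adv: "advection_solution V T L \<rho>" and s: "s \<in> {0..T}"
  shows "exit_flow V L \<rho> s =
    integral {max 0 (L - V * s)..L} (\<rho> 0) + integral {0..max 0 (s - L / V)} (\<lambda>t. V * \<rho> t 0)"
proof -
  obtain p p' :: "real \<Rightarrow> real" where p: "\<And>u. (p has_real_derivative p' u) (at u)"
    and p'c: "continuous_on UNIV p'" and p0: "\<And>u. u \<le> 0 \<Longrightarrow> p u = 0"
    and p1: "\<And>u. \<bar>p u\<bar> \<le> 1"
    and plim: "\<And>u. u > 0 \<Longrightarrow> (\<lambda>k. p (real (k::nat) * u)) \<longlonglongrightarrow> 1"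
    using C1_cutoff_exists by blast
  have pc: "continuous_on A p" for A
    using p by (meson DERIV_isCont continuous_at_imp_continuous_on)
  have pcut: "(\<lambda>k. p (real (k::nat) * u)) \<longlonglongrightarrow> (if P then 1 else 0)" if "u > 0 \<longleftrightarrow> P" for u P
    using plim[of u] p0 that by (auto simp: mult_nonneg_nonpos not_less)
  \<comment> \<open>\<open>z t x\<close> is \<open>s\<close> minus the time at which a product
    located at \<open>x\<close> at time \<open>t\<close> reaches the exit. It is positive exactly
    for products that leave before \<open>s\<close>.\<close>
  define z where "z t x = s - t - (L - x) / V" for t x
  define \<phi> where "\<phi> k t x = p (real k * z t x)" for k :: nat and t x
  have id: "integral {0..L} (\<lambda>x. \<rho> 0 x * \<phi> k 0 x) + integral {0..T} (\<lambda>t. V * \<rho> t 0 * \<phi> k t 0)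
      = integral {0..T} (\<lambda>t. V * \<rho> t L * \<phi> k t L)" for k
  proof -
    define \<phi>t where "\<phi>t t x = - real k * p' (real k * z t x)" for t x
    define \<phi>x where "\<phi>x t x = real k / V * p' (real k * z t x)" for t x
    have zc: "continuous_on UNIV (\<lambda>w. p' (real k * z (fst w) (snd w)))"
      unfolding z_def using \<open>V > 0\<close>
      by (intro continuous_on_compose2[OF p'c] continuous_intros) auto
    have "C1_partials (\<phi> k) \<phi>t \<phi>x"
      unfolding C1_partials_def
    proof (intro conjI allI)
      fix t x
      have "((\<lambda>s. p (real k * z s x)) has_real_derivative
          p' (real k * z t x) * (- real k)) (at t)"
        by (rule DERIV_chain2[OF p]) (auto simp: z_def intro!: derivative_eq_intros)
      then show "((\<lambda>s. \<phi> k s x) has_real_derivative \<phi>t t x) (at t)"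
        by (simp add: \<phi>_def \<phi>t_def mult.commute)
      have "((\<lambda>y. p (real k * z t y)) has_real_derivative
          p' (real k * z t x) * (real k / V)) (at x)"
        by (rule DERIV_chain2[OF p]) (use \<open>V > 0\<close> in \<open>auto simp: z_def intro!: derivative_eq_intros\<close>)
      then show "((\<lambda>y. \<phi> k t y) has_real_derivative \<phi>x t x) (at x)"
        by (simp add: \<phi>_def \<phi>x_def mult.commute)
    next
      show "continuous_on UNIV (\<lambda>(t, x). \<phi>t t x)" "continuous_on UNIV (\<lambda>(t, x). \<phi>x t x)"
        unfolding \<phi>t_def \<phi>x_def case_prod_beta by (intro continuous_intros zc)+
    qed
    \<comment> \<open>This is where \<open>s \<le> T\<close> enters: from time \<open>T\<close> on,
      nothing on the processor can still reach the exit before \<open>s\<close>.\<close>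
    moreover have "\<forall>t\<ge>T. \<forall>x\<in>{0..L}. \<phi> k t x = 0"
    proof (intro allI impI ballI)
      fix t x assume "T \<le> t" "x \<in> {0..L}"
      then have "s - t \<le> 0" "(L - x) / V \<ge> 0" using s \<open>V > 0\<close> by auto
      then have "z t x \<le> 0" by (simp add: z_def)
      then show "\<phi> k t x = 0" by (simp add: \<phi>_def p0 mult_nonneg_nonpos)
    qed
    ultimately have "integral ({0..T} \<times> {0..L}) (\<lambda>(t, x). \<rho> t x * (\<phi>t t x + V * \<phi>x t x))
        + integral {0..L} (\<lambda>x. \<rho> 0 x * \<phi> k 0 x)
        + integral {0..T} (\<lambda>t. V * \<rho> t 0 * \<phi> k t 0)
        - integral {0..T} (\<lambda>t. V * \<rho> t L * \<phi> k t L) = 0"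
      using adv unfolding advection_solution_def by blast
    moreover have "\<phi>t t x + V * \<phi>x t x = 0" for t x
      using \<open>V > 0\<close> by (simp add: \<phi>t_def \<phi>x_def)
    ultimately show ?thesis
      by (simp add: case_prod_unfold)
  qed
  have int: "(\<lambda>x. \<rho> 0 x) absolutely_integrable_on {0..L}"
    "(\<lambda>t. V * \<rho> t 0) absolutely_integrable_on {0..T}"
    "(\<lambda>t. V * \<rho> t L) absolutely_integrable_on {0..T}"
    using adv unfolding advection_solution_def by (auto intro!: set_integrable_mult_right)
  have cont: "continuous_on A (\<lambda>x. \<phi> k t x)" "continuous_on A (\<lambda>t. \<phi> k t x)" for A k t x
    unfolding \<phi>_def z_def using \<open>V > 0\<close>
    by (auto intro!: continuous_on_compose2[OF pc[of UNIV]] continuous_intros)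
  have "(\<lambda>k. integral {0..L} (\<lambda>x. \<rho> 0 x * \<phi> k 0 x)) \<longlonglongrightarrow>
      integral ({x. L - V * s < x} \<inter> {0..L}) (\<rho> 0)"
  proof (intro tendsto_integral_mult_cutoff int cont)
    fix x
    have "z 0 x > 0 \<longleftrightarrow> x \<in> {x. L - V * s < x}"
      using \<open>V > 0\<close> by (simp add: z_def field_simps)
    then show "(\<lambda>k. \<phi> k 0 x) \<longlonglongrightarrow> (if x \<in> {x. L - V * s < x} then 1 else 0)"
      unfolding \<phi>_def by (rule pcut)
  qed (simp add: \<phi>_def p1)
  moreover have "(\<lambda>k. integral {0..T} (\<lambda>t. V * \<rho> t 0 * \<phi> k t 0)) \<longlonglongrightarrow>
      integral ({t. t < s - L / V} \<inter> {0..T}) (\<lambda>t. V * \<rho> t 0)"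
  proof (intro tendsto_integral_mult_cutoff int cont)
    fix t
    have "z t 0 > 0 \<longleftrightarrow> t \<in> {t. t < s - L / V}" by (auto simp: z_def)
    then show "(\<lambda>k. \<phi> k t 0) \<longlonglongrightarrow> (if t \<in> {t. t < s - L / V} then 1 else 0)"
      unfolding \<phi>_def by (rule pcut)
  qed (simp add: \<phi>_def p1)
  ultimately have "(\<lambda>k. integral {0..T} (\<lambda>t. V * \<rho> t L * \<phi> k t L)) \<longlonglongrightarrow>
      integral ({x. L - V * s < x} \<inter> {0..L}) (\<rho> 0)
      + integral ({t. t < s - L / V} \<inter> {0..T}) (\<lambda>t. V * \<rho> t 0)"
    unfolding id[symmetric] by (rule tendsto_add)
  moreover have "(\<lambda>k. integral {0..T} (\<lambda>t. V * \<rho> t L * \<phi> k t L)) \<longlonglongrightarrow>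
      integral ({t. t < s} \<inter> {0..T}) (\<lambda>t. V * \<rho> t L)"
  proof (intro tendsto_integral_mult_cutoff int cont)
    fix t
    have "z t L > 0 \<longleftrightarrow> t \<in> {t. t < s}" by (simp add: z_def)
    then show "(\<lambda>k. \<phi> k t L) \<longlonglongrightarrow> (if t \<in> {t. t < s} then 1 else 0)"
      unfolding \<phi>_def by (rule pcut)
  qed (simp add: \<phi>_def p1)
  ultimately have "integral ({t. t < s} \<inter> {0..T}) (\<lambda>t. V * \<rho> t L) =
      integral ({x. L - V * s < x} \<inter> {0..L}) (\<rho> 0)
      + integral ({t. t < s - L / V} \<inter> {0..T}) (\<lambda>t. V * \<rho> t 0)"
    using LIMSEQ_unique by blast
  \<comment> \<open>The strict inequalities stem from the cutoff vanishing at 0. Passing to closed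
    intervals changes each of the three sets by at most one point.\<close>
  moreover have "integral ({t. t < s} \<inter> {0..T}) (\<lambda>t. V * \<rho> t L) = exit_flow V L \<rho> s"
    unfolding exit_flow_def using s
    by (intro integral_subset_negligible) (auto intro: negligible_subset[of "{s}"])
  moreover have "integral ({x. L - V * s < x} \<inter> {0..L}) (\<rho> 0) =
      integral {max 0 (L - V * s)..L} (\<rho> 0)"
  proof (rule integral_subset_negligible)
    have "{max 0 (L - V * s)..L} - {x. L - V * s < x} \<inter> {0..L} \<subseteq> {max 0 (L - V * s)}"
      by auto
    then show "negligible ({max 0 (L - V * s)..L} - {x. L - V * s < x} \<inter> {0..L})"
      by (rule negligible_subset[rotated]) simp
  qed auto
  moreover have "integral ({t. t < s - L / V} \<inter> {0..T}) (\<lambda>t. V * \<rho> t 0) =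
      integral {0..max 0 (s - L / V)} (\<lambda>t. V * \<rho> t 0)"
  proof (intro integral_subset_negligible)
    have "L / V > 0" using \<open>V > 0\<close> \<open>L > 0\<close> by simp
    then have "{0..max 0 (s - L / V)} - {t. t < s - L / V} \<inter> {0..T} \<subseteq> {max 0 (s - L / V)}"
      using s by (auto simp: max_def split: if_splits)
    then show "negligible ({0..max 0 (s - L / V)} - {t. t < s - L / V} \<inter> {0..T})"
      by (rule negligible_subset[rotated]) simp
  qed auto
  ultimately show ?thesis by linarith
qed

section \<open>Monotonicity and Lipschitz continuity of the release profile\<close>

lemma Q_hat_ge_0:
  assumes "q0 \<ge> 0" "inflow_profile T \<Xi> Q" "t \<le> T"
  shows "Q_hat q0 Q t \<ge> 0"
  using assms by (auto simp: Q_hat_def inflow_profile_def Pi_iff not_le)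

lemma Q_hat_mono:
  assumes "q0 \<ge> 0" "inflow_profile T \<Xi> Q" "t \<le> t'" "t' \<le> T"
  shows "Q_hat q0 Q t \<le> Q_hat q0 Q t'"
  using assms Q_hat_ge_0[OF assms(1,2,4)]
  by (auto simp: Q_hat_def inflow_profile_def mono_on_def)

lemma bdd_below_release:
  assumes "\<mu> > 0" "q0 \<ge> 0" "inflow_profile T \<Xi> Q" "t \<le> T"
  shows "bdd_below ((\<lambda>\<tau>. Q_hat q0 Q \<tau> + \<mu> * (t - \<tau>)) ` {..t})"
  using assms Q_hat_ge_0[OF assms(2,3)] by (auto intro!: bdd_belowI2[of _ 0])

text \<open>A competitor \<open>\<tau>\<close> at the later time is matched by
  \<open>min t \<tau>\<close> at the earlier one: cutting \<open>\<tau>\<close> back lowers the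
  arrivals, and the remaining time span does not grow.\<close>

lemma release_profile_mono:
  assumes "\<mu> > 0" "q0 \<ge> 0" "inflow_profile T \<Xi> Q" "t \<le> t'" "t' \<le> T"
  shows "release_profile \<mu> q0 Q t \<le> release_profile \<mu> q0 Q t'"
  unfolding release_profile_def
proof (rule cINF_mono)
  fix \<tau> assume \<tau>: "\<tau> \<in> {..t'}"
  show "\<exists>\<sigma>\<in>{..t}. Q_hat q0 Q \<sigma> + \<mu> * (t - \<sigma>) \<le> Q_hat q0 Q \<tau> + \<mu> * (t' - \<tau>)"
  proof (rule bexI[of _ "min t \<tau>"])
    have "\<mu> * (t - min t \<tau>) \<le> \<mu> * (t' - \<tau>)"
      using assms \<tau> by (intro mult_left_mono) auto
    then show "Q_hat q0 Q (min t \<tau>) + \<mu> * (t - min t \<tau>) \<le> Q_hat q0 Q \<tau> + \<mu> * (t' - \<tau>)"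
      using Q_hat_mono[OF assms(2,3), of "min t \<tau>" \<tau>] assms(5) \<tau>
      by (intro add_mono) auto
  qed auto
qed (use assms in \<open>auto intro!: bdd_below_release\<close>)

text \<open>Each \<open>\<tau> \<le> t\<close> is still a competitor at time \<open>t'\<close>, at
  an extra cost of \<open>\<mu> * (t' - t)\<close>. This is the capacity bound on the release
  rate.\<close>

lemma release_profile_add_le:
  assumes "\<mu> > 0" "q0 \<ge> 0" "inflow_profile T \<Xi> Q" "t \<le> t'" "t' \<le> T"
  shows "release_profile \<mu> q0 Q t' \<le> release_profile \<mu> q0 Q t + \<mu> * (t' - t)"
proof -
  have "release_profile \<mu> q0 Q t' - \<mu> * (t' - t) \<le> release_profile \<mu> q0 Q t"
    unfolding release_profile_def[of \<mu> q0 Q t]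
  proof (rule cINF_greatest)
    fix \<tau> assume "\<tau> \<in> {..t}"
    then have "release_profile \<mu> q0 Q t' \<le> Q_hat q0 Q \<tau> + \<mu> * (t' - \<tau>)"
      unfolding release_profile_def using assms
      by (intro cINF_lower bdd_below_release) auto
    then show "release_profile \<mu> q0 Q t' - \<mu> * (t' - t) \<le> Q_hat q0 Q \<tau> + \<mu> * (t - \<tau>)"
      by (simp add: algebra_simps)
  qed simp
  then show ?thesis by simp
qed

lemma release_profile_lipschitz:
  assumes "\<mu> > 0" "q0 \<ge> 0" "inflow_profile T \<Xi> Q"
  shows "\<mu>-lipschitz_on {..T} (release_profile \<mu> q0 Q)"
proof (rule lipschitz_onI)
  fix t t' assume tt': "t \<in> {..T}" "t' \<in> {..T}"
  show "dist (release_profile \<mu> q0 Q t) (release_profile \<mu> q0 Q t') \<le> \<mu> * dist t t'"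
    using release_profile_mono[OF assms, of t t'] release_profile_add_le[OF assms, of t t']
      release_profile_mono[OF assms, of t' t] release_profile_add_le[OF assms, of t' t] tt'
    by (cases "t \<le> t'") (auto simp: dist_real_def)
qed (use assms in simp)

text \<open>Up to time 0 only the term \<open>- \<mu> * \<tau>\<close> remains, which is smallest at
  0. The initial queue enters \<open>Q_hat\<close> only after time 0, so it is not released in one
  instant.\<close>

lemma release_profile_0:
  assumes "\<mu> > 0"
  shows "release_profile \<mu> q0 Q 0 = 0"
  unfolding release_profile_def
proof (rule cInf_eq_minimum)
  show "0 \<in> (\<lambda>\<tau>. Q_hat q0 Q \<tau> + \<mu> * (0 - \<tau>)) ` {..0}"
    by (rule image_eqI[of _ _ 0]) (auto simp: Q_hat_def)
qed (use assms in \<open>auto simp: Q_hat_def mult_nonneg_nonpos\<close>)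

section \<open>Reducing the infimum to finitely many times\<close>

text \<open>On the affine stretch around a time that is not a break point, the function decreases towards
  one of the two ends. Its value at that end is no larger than the one-sided limit from inside:
  at the left end because jumps go up, at the right end by left continuity.\<close>

lemma Q_hat_minus_linear_minimizer:
  assumes "\<mu> > 0" "q0 \<ge> 0" "inflow_profile T \<Xi> Q" "s \<in> {0..T}" "\<tau> \<le> s"
  shows "\<exists>\<omega>\<in>{\<xi> \<in> \<Xi>. \<xi> \<le> s} \<union> {s}. Q_hat q0 Q \<omega> - \<mu> * \<omega> \<le> Q_hat q0 Q \<tau> - \<mu> * \<tau>"
proof -
  have pa: "0 \<in> \<Xi>" "finite (\<Xi> \<inter> {..T})"
    and aff: "\<And>a b. \<lbrakk>0 \<le> a; a < b; b \<le> T; {a<..<b} \<inter> \<Xi> = {}\<rbrakk> \<Longrightarrow>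
        \<exists>c d. \<forall>t\<in>{a<..<b}. Q t = c + d * t"
    and lcont: "\<And>t. t \<in> {0<..T} \<Longrightarrow> continuous (at_left t) Q"
    using assms(3) by (auto simp: inflow_profile_def piecewise_affine_def)
  consider "\<tau> \<le> 0" | "0 < \<tau>" "\<tau> \<in> \<Xi> \<union> {s}" | "0 < \<tau>" "\<tau> \<notin> \<Xi>" "\<tau> < s"
    using \<open>\<tau> \<le> s\<close> by fastforce
  then show ?thesis
  proof cases
    \<comment> \<open>No arrivals are counted up to time 0, so the objective is
      \<open>- \<mu> * \<tau> \<ge> 0\<close>, while the break point 0 gives the value 0.\<close>
    case 1
    then show ?thesis
      using assms pa by (intro bexI[of _ 0]) (auto simp: Q_hat_def mult_nonneg_nonpos)
  next
    case 2
    then show ?thesis using \<open>\<tau> \<le> s\<close> by (intro bexI[of _ \<tau>]) auto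
  next
    case 3
    \<comment> \<open>\<open>Max A\<close> and \<open>Min B\<close> are the neighbours of
      \<open>\<tau>\<close> among the break points. Having 0 in \<open>A\<close> and
      \<open>s\<close> in \<open>B\<close> makes both sets nonempty and keeps the stretch between
      them inside [0, s].\<close>
    define A where "A = {\<xi> \<in> \<Xi>. \<xi> < \<tau>}"
    define B where "B = {\<xi> \<in> \<Xi>. \<tau> < \<xi> \<and> \<xi> < s} \<union> {s}"
    have fin: "finite A" "finite B"
      unfolding A_def B_def using assms 3 by (auto intro: finite_subset[OF _ pa(2)])
    have "0 \<in> A" using pa 3 by (auto simp: A_def)
    have "s \<in> B" by (simp add: B_def)
    define a where "a = Max A"
    define b where "b = Min B"
    have aA: "a \<in> A" and a0: "0 \<le> a"
      unfolding a_def using fin \<open>0 \<in> A\<close> by (auto intro: Max_in)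
    have bB: "b \<in> B" and bs: "b \<le> s"
      unfolding b_def using fin \<open>s \<in> B\<close> by (auto intro: Min_in)
    have ab: "a < \<tau>" "\<tau> < b" "b \<le> T"
      using aA bB bs 3 assms by (auto simp: A_def B_def)
    have "{a<..<b} \<inter> \<Xi> = {}"
    proof (rule ccontr)
      assume "{a<..<b} \<inter> \<Xi> \<noteq> {}"
      then obtain \<xi> where \<xi>: "\<xi> \<in> \<Xi>" "a < \<xi>" "\<xi> < b" by auto
      then have "\<xi> \<in> A \<or> \<xi> \<in> B" using 3 bs by (cases \<xi> \<tau> rule: linorder_cases) (auto simp: A_def B_def)
      then have "\<xi> \<le> a \<or> b \<le> \<xi>"
        unfolding a_def b_def using fin by (auto intro: Max_ge Min_le)
      then show False using \<xi> by linarith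
    qed
    then obtain c d where cd: "\<And>t. t \<in> {a<..<b} \<Longrightarrow> Q t = c + d * t"
      using aff[of a b] a0 ab by fastforce
    have Qcd: "Q_hat q0 Q t = q0 + c + d * t" if "t \<in> {a<..<b}" for t
      using cd[OF that] that a0 by (simp add: Q_hat_def)
    show ?thesis
    proof (cases "d \<ge> \<mu>")
      case True
      \<comment> \<open>Only an inequality holds at \<open>a\<close>, because \<open>Q_hat\<close>
        may jump upward just after it; for \<open>a = 0\<close> such a jump includes the initial
        queue.\<close>
      have "Q_hat q0 Q a \<le> q0 + c + d * a"
      proof (rule tendsto_lowerbound)
        show "((\<lambda>t. q0 + c + d * t) \<longlongrightarrow> q0 + c + d * a) (at_right a)"
          by (intro tendsto_intros)
        have "\<forall>\<^sub>F t in at_right a. t \<in> {a<..<b}"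
          using ab by (intro eventually_at_right_real) simp
        then show "\<forall>\<^sub>F t in at_right a. Q_hat q0 Q a \<le> q0 + c + d * t"
        proof eventually_elim
          case (elim t)
          then have "Q_hat q0 Q a \<le> Q_hat q0 Q t"
            using ab by (intro Q_hat_mono[OF assms(2,3)]) auto
          then show ?case using Qcd[OF elim] by simp
        qed
      qed simp
      moreover have "(d - \<mu>) * a \<le> (d - \<mu>) * \<tau>"
        using True ab by (intro mult_left_mono) auto
      moreover have "a \<in> {\<xi> \<in> \<Xi>. \<xi> \<le> s}" using aA 3 by (auto simp: A_def)
      ultimately show ?thesis
        using Qcd[of \<tau>] ab by (intro bexI[of _ a]) (auto simp: algebra_simps)
    next
      case False
      \<comment> \<open>At the right end the affine formula extends exactly, by left continuity,
        whether \<open>b\<close> is a break point or \<open>s\<close>.\<close>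
      have "Q b = c + d * b"
      proof (rule tendsto_unique)
        show "(Q \<longlongrightarrow> Q b) (at_left b)"
          using lcont[of b] ab a0 by (simp add: continuous_within)
        have "\<forall>\<^sub>F t in at_left b. c + d * t = Q t"
          using eventually_at_left_real[of a b] ab by (auto elim!: eventually_mono simp: cd)
        moreover have "((\<lambda>t. c + d * t) \<longlongrightarrow> c + d * b) (at_left b)"
          by (intro tendsto_intros)
        ultimately show "(Q \<longlongrightarrow> c + d * b) (at_left b)"
          by (rule Lim_transform_eventually[rotated])
      qed simp
      then have "Q_hat q0 Q b = q0 + c + d * b"
        using ab a0 by (simp add: Q_hat_def)
      moreover have "(\<mu> - d) * \<tau> \<le> (\<mu> - d) * b"
        using False ab by (intro mult_left_mono) auto
      moreover have "b \<in> {\<xi> \<in> \<Xi>. \<xi> \<le> s} \<union> {s}" using bB by (auto simp: B_def)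
      ultimately show ?thesis
        using Qcd[of \<tau>] ab by (intro bexI[of _ b]) (auto simp: algebra_simps)
    qed
  qed
qed

text \<open>The term \<open>\<mu> * s\<close> is common to all competitors and can be split off. The
  minimum over the finite set is attained at some time up to \<open>s\<close>, so it is among the
  competing values, and by the preceding lemma no other time beats it.\<close>

lemma release_profile_eq_Min:
  assumes "\<mu> > 0" "q0 \<ge> 0" "inflow_profile T \<Xi> Q" "t - L / V \<in> {0..T}"
  shows "release_profile \<mu> q0 Q (t - L / V) =
    Min ((\<lambda>\<tau>. Q_hat q0 Q \<tau> - \<mu> * \<tau>) ` Omega \<Xi> L V t) + (t - L / V) * \<mu>"
proof -
  define s where "s = t - L / V"
  define M where "M = Min ((\<lambda>\<tau>. Q_hat q0 Q \<tau> - \<mu> * \<tau>) ` Omega \<Xi> L V t)"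
  have "finite (\<Xi> \<inter> {..T})"
    using assms(3) by (simp add: inflow_profile_def piecewise_affine_def)
  then have fin: "finite (Omega \<Xi> L V t)"
    unfolding Omega_def using assms(4) by (auto intro: finite_subset[rotated])
  have ne: "Omega \<Xi> L V t \<noteq> {}" by (simp add: Omega_def)
  have "M \<in> (\<lambda>\<tau>. Q_hat q0 Q \<tau> - \<mu> * \<tau>) ` Omega \<Xi> L V t"
    unfolding M_def using fin ne by (intro Min_in) auto
  then obtain \<omega> where \<omega>: "\<omega> \<le> s" "M = Q_hat q0 Q \<omega> - \<mu> * \<omega>"
    by (auto simp: Omega_def s_def)
  have "release_profile \<mu> q0 Q s = M + s * \<mu>"
    unfolding release_profile_def
  proof (rule cInf_eq_minimum)
    show "M + s * \<mu> \<in> (\<lambda>\<tau>. Q_hat q0 Q \<tau> + \<mu> * (s - \<tau>)) ` {..s}"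
      using \<omega> by (intro image_eqI[of _ _ \<omega>]) (auto simp: algebra_simps)
  next
    fix y assume "y \<in> (\<lambda>\<tau>. Q_hat q0 Q \<tau> + \<mu> * (s - \<tau>)) ` {..s}"
    then obtain \<tau> where \<tau>: "\<tau> \<le> s" "y = Q_hat q0 Q \<tau> + \<mu> * (s - \<tau>)" by auto
    obtain \<omega>' where "\<omega>' \<in> Omega \<Xi> L V t" "Q_hat q0 Q \<omega>' - \<mu> * \<omega>' \<le> Q_hat q0 Q \<tau> - \<mu> * \<tau>"
      using Q_hat_minus_linear_minimizer[OF assms(1-3), of s \<tau>] assms(4) \<tau>
      unfolding Omega_def s_def by blast
    moreover from this have "M \<le> Q_hat q0 Q \<omega>' - \<mu> * \<omega>'"
      unfolding M_def using fin by (intro Min_le) auto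
    ultimately show "M + s * \<mu> \<le> y" using \<tau> by (simp add: algebra_simps)
  qed
  then show ?thesis by (simp add: s_def M_def)
qed

section \<open>Tail integrals and assembly of the exit formula\<close>

lemma AE_lebesgue_obtain_negligible:
  assumes "AE x\<in>S in lebesgue. P x"
  obtains N where "negligible N" "\<And>x. x \<in> S - N \<Longrightarrow> P x"
  using assms by (auto elim!: AE_E3 simp: negligible_iff_null_sets)

text \<open>Resetting \<open>f\<close> to 0 on the exceptional null set keeps all integrals and
  turns the a.e. bound into a pointwise one. The absolute value provides a nonnegative constant even
  for negative \<open>M\<close>, which can occur over a negligible interval.\<close>

lemma lipschitz_on_integral_tail:
  fixes f :: "real \<Rightarrow> real"
  assumes f: "f integrable_on {0..L}" and bd: "AE x\<in>{0..L} in lebesgue. \<bar>f x\<bar> \<le> M"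
  shows "\<bar>M\<bar>-lipschitz_on {0..L} (\<lambda>x. integral {x..L} f)"
proof -
  obtain N where N: "negligible N" "\<And>x. x \<in> {0..L} - N \<Longrightarrow> \<bar>f x\<bar> \<le> M"
    using AE_lebesgue_obtain_negligible[OF bd] by blast
  define g where "g x = (if x \<in> N then 0 else f x)" for x
  have g: "\<bar>g x\<bar> \<le> \<bar>M\<bar>" if "x \<in> {0..L}" for x
    using N(2)[of x] that by (auto simp: g_def)
  have eq: "integral S f = integral S g" for S
    by (rule integral_spike[OF N(1)]) (simp add: g_def)
  have gi: "g integrable_on {0..L}"
    by (rule integrable_spike[OF f N(1)]) (simp add: g_def)
  have key: "\<bar>integral {x..L} g - integral {y..L} g\<bar> \<le> \<bar>M\<bar> * (y - x)"
    if "0 \<le> x" "x \<le> y" "y \<le> L" for x y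
  proof -
    have "integral {x..y} g + integral {y..L} g = integral {x..L} g"
      using that by (intro Henstock_Kurzweil_Integration.integral_combine
          integrable_on_subinterval[OF gi]) auto
    moreover have "\<bar>integral {x..y} g\<bar> \<le> \<bar>M\<bar> * (y - x)"
    proof -
      have "g integrable_on {x..y}"
        using that by (intro integrable_on_subinterval[OF gi]) auto
      then have "norm (integral {x..y} g) \<le> integral {x..y} (\<lambda>_. \<bar>M\<bar>)"
        using that g by (intro integral_norm_bound_integral) auto
      then show ?thesis using that by (simp add: mult.commute)
    qed
    ultimately show ?thesis by simp
  qed
  show ?thesis
  proof (rule lipschitz_onI)
    fix x y assume "x \<in> {0..L}" "y \<in> {0..L}"
    then show "dist (integral {x..L} f) (integral {y..L} f) \<le> \<bar>M\<bar> * dist x y"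
      using key[of x y] key[of y x] by (cases "x \<le> y") (auto simp: eq dist_real_def)
  qed simp
qed

text \<open>The Lipschitz claim is split at time L / V because up to then the exit flow is a
  primitive of the initial density: integrability alone makes it absolutely continuous, while an
  essential bound makes it Lipschitz.\<close>

theorem proposition3p4:
  fixes \<mu> L V T q0 :: real
    and \<Xi> :: "real set"
    and Q \<rho>0 :: "real \<Rightarrow> real"
    and \<rho> :: "real \<Rightarrow> real \<Rightarrow> real"
  assumes "\<mu> > 0" and "L > 0" and "V > 0" and "T > 0" and "q0 \<ge> 0"
    and "inflow_profile T \<Xi> Q"
    and "\<rho>0 absolutely_integrable_on {0..L}"
    and "advection_solution V T L \<rho>"
    and "AE x\<in>{0..L} in lebesgue. \<rho> 0 x = \<rho>0 x"
    and "AE t\<in>{0..T} in lebesgue.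
           (release_profile \<mu> q0 Q has_real_derivative V * \<rho> t 0) (at t)"
  shows "(\<forall>t\<in>{0..T}. exit_flow V L \<rho> t =
            (if t < L / V
             then integral {L - V * t..L} \<rho>0
             else Min ((\<lambda>\<tau>. Q_hat q0 Q \<tau> - \<mu> * \<tau>) ` Omega \<Xi> L V t)
                  + (t - L / V) * \<mu> + integral {0..L} \<rho>0)) \<and>
         (\<exists>C. C-lipschitz_on {L / V..T} (exit_flow V L \<rho>)) \<and>
         ((\<exists>M. AE x\<in>{0..L} in lebesgue. \<bar>\<rho>0 x\<bar> \<le> M) \<longrightarrow>
            (\<exists>C. C-lipschitz_on {0..T} (exit_flow V L \<rho>)))"
proof -
  let ?R = "release_profile \<mu> q0 Q"
  obtain N0 where N0: "negligible N0" "\<And>x. x \<in> {0..L} - N0 \<Longrightarrow> \<rho> 0 x = \<rho>0 x"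
    using AE_lebesgue_obtain_negligible[OF assms(9)] by blast
  obtain N1 where N1: "negligible N1"
    "\<And>t. t \<in> {0..T} - N1 \<Longrightarrow> (?R has_real_derivative V * \<rho> t 0) (at t)"
    using AE_lebesgue_obtain_negligible[OF assms(10)] by blast
  have LV: "L / V > 0" using assms by simp
  have lip: "\<mu>-lipschitz_on {..T} ?R"
    using assms by (intro release_profile_lipschitz)
  \<comment> \<open>One expression serves both regimes: before L / V the release term is
    \<open>?R 0 = 0\<close>, and afterwards the first integral is the whole initial mass.\<close>
  have flow: "exit_flow V L \<rho> t =
      integral {max 0 (L - V * t)..L} \<rho>0 + ?R (max 0 (t - L / V))" if t: "t \<in> {0..T}" for t
  proof -
    define b where "b = max 0 (t - L / V)"
    have b: "0 \<le> b" "b \<le> T" using t LV by (auto simp: b_def)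
    have "((\<lambda>t. V * \<rho> t 0) has_integral ?R b - ?R 0) {0..b}"
      using b N1(2)
      by (intro has_integral_derivative_of_lipschitz[OF b(1) lipschitz_on_subset[OF lip] N1(1)]) auto
    then have "integral {0..b} (\<lambda>t. V * \<rho> t 0) = ?R b"
      unfolding release_profile_0[OF assms(1)] diff_0_right by (rule integral_unique)
    moreover have "integral {max 0 (L - V * t)..L} (\<rho> 0) = integral {max 0 (L - V * t)..L} \<rho>0"
      using N0 by (intro integral_spike[OF N0(1)]) auto
    ultimately show ?thesis
      using exit_flow_eq_integrals[OF assms(3,2,8) t] by (simp add: b_def)
  qed
  have formula: "exit_flow V L \<rho> t =
            (if t < L / V
             then integral {L - V * t..L} \<rho>0
             else Min ((\<lambda>\<tau>. Q_hat q0 Q \<tau> - \<mu> * \<tau>) ` Omega \<Xi> L V t)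
                  + (t - L / V) * \<mu> + integral {0..L} \<rho>0)" if t: "t \<in> {0..T}" for t
  proof (cases "t < L / V")
    case True
    then have "L - V * t > 0" using assms by (simp add: field_simps)
    then show ?thesis
      using flow[OF t] True release_profile_0[OF assms(1)] by (simp add: max_def)
  next
    case False
    then have "L - V * t \<le> 0" using assms by (simp add: field_simps)
    moreover have "?R (t - L / V) =
        Min ((\<lambda>\<tau>. Q_hat q0 Q \<tau> - \<mu> * \<tau>) ` Omega \<Xi> L V t) + (t - L / V) * \<mu>"
      using False t LV by (intro release_profile_eq_Min[OF assms(1,5,6)]) auto
    ultimately show ?thesis
      using flow[OF t] False by (simp add: max_def)
  qed
  have lipR: "(\<mu> * 1)-lipschitz_on {0..T} (\<lambda>t. ?R (max 0 (t - L / V)))"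
  proof (rule lipschitz_on_compose2[where f = "\<lambda>t. max 0 (t - L / V)"])
    show "1-lipschitz_on {0..T} (\<lambda>t. max 0 (t - L / V))"
      by (rule lipschitz_onI) (auto simp: dist_real_def max_def)
    show "\<mu>-lipschitz_on ((\<lambda>t. max 0 (t - L / V)) ` {0..T}) ?R"
      using LV by (intro lipschitz_on_subset[OF lip]) force
  qed
  \<comment> \<open>From time L / V on the initial mass contributes a constant, so only the delayed
    release profile varies.\<close>
  have "(0 + \<mu> * 1)-lipschitz_on {L / V..T} (exit_flow V L \<rho>)"
  proof (rule lipschitz_on_transform)
    show "(0 + \<mu> * 1)-lipschitz_on {L / V..T} (\<lambda>t. integral {0..L} \<rho>0 + ?R (max 0 (t - L / V)))"
      using LV by (intro lipschitz_on_add lipschitz_on_constant lipschitz_on_subset[OF lipR]) auto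
    fix t assume "t \<in> {L / V..T}"
    moreover from this have "L - V * t \<le> 0" using assms by (simp add: field_simps)
    ultimately show "exit_flow V L \<rho> t = integral {0..L} \<rho>0 + ?R (max 0 (t - L / V))"
      using flow[of t] LV by (simp add: max_def)
  qed
  moreover have "\<exists>C. C-lipschitz_on {0..T} (exit_flow V L \<rho>)"
    if "AE x\<in>{0..L} in lebesgue. \<bar>\<rho>0 x\<bar> \<le> M" for M
  proof -
    have "\<rho>0 integrable_on {0..L}"
      using assms(7) by (rule set_lebesgue_integral_eq_integral(1))
    note tail = lipschitz_on_integral_tail[OF this that]
    \<comment> \<open>The lower limit of integration moves at speed at most \<open>V\<close>, whence
      the factor \<open>V\<close> beside the density bound.\<close>
    have "(\<bar>M\<bar> * V)-lipschitz_on {0..T} (\<lambda>t. integral {max 0 (L - V * t)..L} \<rho>0)"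
    proof (rule lipschitz_on_compose2[where f = "\<lambda>t. max 0 (L - V * t)"])
      show "V-lipschitz_on {0..T} (\<lambda>t. max 0 (L - V * t))"
      proof (rule lipschitz_onI)
        fix x y :: real
        have "dist (max 0 (L - V * x)) (max 0 (L - V * y)) \<le> \<bar>V * (x - y)\<bar>"
          by (auto simp: dist_real_def max_def right_diff_distrib)
        then show "dist (max 0 (L - V * x)) (max 0 (L - V * y)) \<le> V * dist x y"
          using assms by (simp add: dist_real_def abs_mult)
      qed (use assms in simp)
      show "\<bar>M\<bar>-lipschitz_on ((\<lambda>t. max 0 (L - V * t)) ` {0..T}) (\<lambda>x. integral {x..L} \<rho>0)"
        using assms by (intro lipschitz_on_subset[OF tail]) auto
    qed
    from lipschitz_on_add[OF this lipR]
    have "(\<bar>M\<bar> * V + \<mu> * 1)-lipschitz_on {0..T} (exit_flow V L \<rho>)"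
      by (rule lipschitz_on_transform) (simp add: flow)
    then show ?thesis ..
  qed
  ultimately show ?thesis using formula by blast
qed

end
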